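(* If $X$ is a finite quandle, then its associated group $\operatorname{As}(X)$ is a residually finite group.
   Context: A quandle is a non-empty set $X$ with a binary operation $*$ such that: (1) $x*x=x$ for all $x\in X$; (2) for any $x,y\in X$ there is a unique $z\in X$ with $x=z*y$; (3) $(x*y)*z=(x*z)*(y*z)$ for all $x,y,z\in X$. The associated group $\operatorname{As}(X)$ of a quandle $X$ is the group generated by the set $\{e_x\mid x\in X\}$ modulo the relations $e_{x*y}=e_y^{-1}e_xe_y$ for all $x,y\in X$. *)

theory Defs
  imports "HOL-Algebra.Coset"
begin

section \<open>Quandles\<close>

locale quandle =
  fixes Q :: "'a set"
    and op :: "'a \<Rightarrow> 'a \<Rightarrow> 'a"  (infixl "\<triangleright>" 70)
  assumes nonempty: "Q \<noteq> {}"
    and closed: "\<lbrakk>x \<in> Q; y \<in> Q\<rbrakk> \<Longrightarrow> x \<triangleright> y \<in> Q"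
    and idem: "x \<in> Q \<Longrightarrow> x \<triangleright> x = x"
    and right_division: "\<lbrakk>x \<in> Q; y \<in> Q\<rbrakk> \<Longrightarrow> \<exists>!z. z \<in> Q \<and> x = z \<triangleright> y"
    and self_distrib:
      "\<lbrakk>x \<in> Q; y \<in> Q; z \<in> Q\<rbrakk> \<Longrightarrow> (x \<triangleright> y) \<triangleright> z = (x \<triangleright> z) \<triangleright> (y \<triangleright> z)"


section \<open>Groups given by generators and relations\<close>

text \<open>
  A word over \<open>S\<close> is a list of letters; \<open>(s, True)\<close> stands for the generator \<open>s\<close> and
  \<open>(s, False)\<close> for its formal inverse. A pair \<open>(u, v)\<close> of words in \<open>R\<close> is the
  relation \<open>u = v\<close>.
\<close>

type_synonym 'a word = "('a \<times> bool) list"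

abbreviation words :: "'a set \<Rightarrow> 'a word set" where
  "words S \<equiv> lists (S \<times> UNIV)"

inductive_set pres_rel :: "'a set \<Rightarrow> ('a word \<times> 'a word) set \<Rightarrow> ('a word \<times> 'a word) set"
  for S R where
  refl: "u \<in> words S \<Longrightarrow> (u, u) \<in> pres_rel S R"
| sym: "(u, v) \<in> pres_rel S R \<Longrightarrow> (v, u) \<in> pres_rel S R"
| trans: "\<lbrakk>(u, v) \<in> pres_rel S R; (v, w) \<in> pres_rel S R\<rbrakk> \<Longrightarrow> (u, w) \<in> pres_rel S R"
| append: "\<lbrakk>(u, v) \<in> pres_rel S R; (u', v') \<in> pres_rel S R\<rbrakk>
    \<Longrightarrow> (u @ u', v @ v') \<in> pres_rel S R"
| cancel: "s \<in> S \<Longrightarrow> ([(s, b), (s, \<not> b)], []) \<in> pres_rel S R"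
| relation: "\<lbrakk>(u, v) \<in> R; u \<in> words S; v \<in> words S\<rbrakk> \<Longrightarrow> (u, v) \<in> pres_rel S R"

definition presented_group :: "'a set \<Rightarrow> ('a word \<times> 'a word) set \<Rightarrow> 'a word set monoid" where
  "presented_group S R =
    \<lparr>carrier = words S // pres_rel S R,
     mult = (\<lambda>A B. \<Union>u\<in>A. \<Union>v\<in>B. pres_rel S R `` {u @ v}),
     one = pres_rel S R `` {[]}\<rparr>"

lemma pres_rel_words: "(u, v) \<in> pres_rel S R \<Longrightarrow> u \<in> words S \<and> v \<in> words S"
  by (induction rule: pres_rel.induct) auto

lemma equiv_pres_rel: "equiv (words S) (pres_rel S R)"
proof (rule equivI)
  show "pres_rel S R \<subseteq> words S \<times> words S"
    using pres_rel_words by fastforce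
  show "refl_on (words S) (pres_rel S R)"
    unfolding refl_on_def by (blast intro: pres_rel.refl)
  show "sym (pres_rel S R)"
    by (rule symI) (rule pres_rel.sym)
  show "trans (pres_rel S R)"
    by (rule transI) (rule pres_rel.trans)
qed

lemma presented_group_mult:
  assumes "u \<in> words S" "v \<in> words S"
  shows "pres_rel S R `` {u} \<otimes>\<^bsub>presented_group S R\<^esub> pres_rel S R `` {v}
    = pres_rel S R `` {u @ v}"
proof -
  have *: "pres_rel S R `` {u' @ v'} = pres_rel S R `` {u @ v}"
    if "(u, u') \<in> pres_rel S R" "(v, v') \<in> pres_rel S R" for u' v'
    using equiv_class_eq[OF equiv_pres_rel pres_rel.append[OF that]] by simp
  have "pres_rel S R `` {u} \<otimes>\<^bsub>presented_group S R\<^esub> pres_rel S R `` {v}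
    = (\<Union>u'\<in>pres_rel S R `` {u}. \<Union>v'\<in>pres_rel S R `` {v}. pres_rel S R `` {u' @ v'})"
    by (simp add: presented_group_def)
  also have "\<dots> = (\<Union>u'\<in>pres_rel S R `` {u}. \<Union>v'\<in>pres_rel S R `` {v}. pres_rel S R `` {u @ v})"
    by (intro SUP_cong HOL.refl *) (simp_all only: Image_singleton_iff)
  also have "\<dots> = pres_rel S R `` {u @ v}"
    using pres_rel.refl[OF assms(1), of R] pres_rel.refl[OF assms(2), of R] by blast
  finally show ?thesis .
qed

lemma pres_rel_inverse:
  assumes "u \<in> words S"
  shows "(rev (map (\<lambda>(s, b). (s, \<not> b)) u) @ u, []) \<in> pres_rel S R"
  using assms
proof (induction u rule: list.induct)
  case Nil
  show ?case by (auto intro: pres_rel.refl)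
next
  case (Cons a u)
  obtain s b where a: "a = (s, b)" by fastforce
  let ?i = "rev (map (\<lambda>(s, b). (s, \<not> b)) u)"
  have u: "u \<in> words S" and s: "s \<in> S" using Cons.prems a by auto
  have i: "?i \<in> words S" using u by (auto simp: in_lists_conv_set)
  have "([(s, \<not> b), (s, b)], []) \<in> pres_rel S R"
    using pres_rel.cancel[OF s, of "\<not> b" R] by simp
  hence "(?i @ ([(s, \<not> b), (s, b)] @ u), ?i @ ([] @ u)) \<in> pres_rel S R"
    using u i by (intro pres_rel.append pres_rel.refl)
  moreover have "(?i @ ([] @ u), []) \<in> pres_rel S R"
    using Cons.IH[OF u] by simp
  ultimately have "(?i @ ([(s, \<not> b), (s, b)] @ u), []) \<in> pres_rel S R"
    by (rule pres_rel.trans)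
  thus ?case by (simp add: a)
qed

lemma group_presented_group: "group (presented_group S R)"
proof (rule groupI)
  let ?G = "presented_group S R" and ?c = "\<lambda>u. pres_rel S R `` {u}"
  have carrier: "carrier ?G = ?c ` words S"
    by (auto simp: presented_group_def quotient_def)
  have one: "\<one>\<^bsub>?G\<^esub> = ?c []"
    by (simp add: presented_group_def)
  have append: "u @ v \<in> words S" if "u \<in> words S" "v \<in> words S" for u v :: "'a word"
    using that by simp
  show "\<one>\<^bsub>?G\<^esub> \<in> carrier ?G"
    unfolding carrier one by blast
  show "x \<otimes>\<^bsub>?G\<^esub> y \<in> carrier ?G" if xy: "x \<in> carrier ?G" "y \<in> carrier ?G" for x y
  proof -
    obtain u v where uv: "u \<in> words S" "v \<in> words S" "x = ?c u" "y = ?c v"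
      using xy unfolding carrier by blast
    show ?thesis
      unfolding uv(3,4) presented_group_mult[OF uv(1,2)] carrier using append uv(1,2) by blast
  qed
  show "x \<otimes>\<^bsub>?G\<^esub> y \<otimes>\<^bsub>?G\<^esub> z = x \<otimes>\<^bsub>?G\<^esub> (y \<otimes>\<^bsub>?G\<^esub> z)"
    if xyz: "x \<in> carrier ?G" "y \<in> carrier ?G" "z \<in> carrier ?G" for x y z
  proof -
    obtain u v w where uvw: "u \<in> words S" "v \<in> words S" "w \<in> words S"
      "x = ?c u" "y = ?c v" "z = ?c w"
      using xyz unfolding carrier by blast
    show ?thesis
      unfolding uvw(4-6)
      by (simp only: presented_group_mult append uvw(1-3) append_assoc)
  qed
  show "\<one>\<^bsub>?G\<^esub> \<otimes>\<^bsub>?G\<^esub> x = x" if x: "x \<in> carrier ?G" for x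
  proof -
    obtain u where u: "u \<in> words S" "x = ?c u"
      using x unfolding carrier by blast
    show ?thesis
      unfolding one u(2) using presented_group_mult[of "[]" S u R] u(1) by simp
  qed
  show "\<exists>y\<in>carrier ?G. y \<otimes>\<^bsub>?G\<^esub> x = \<one>\<^bsub>?G\<^esub>" if x: "x \<in> carrier ?G" for x
  proof -
    obtain u where u: "u \<in> words S" "x = ?c u"
      using x unfolding carrier by blast
    let ?i = "rev (map (\<lambda>(s, b). (s, \<not> b)) u)"
    have i: "?i \<in> words S" using u(1) by (auto simp: in_lists_conv_set)
    have "?c ?i \<otimes>\<^bsub>?G\<^esub> x = \<one>\<^bsub>?G\<^esub>"
      unfolding one u(2) presented_group_mult[OF i u(1)]
      by (rule equiv_class_eq[OF equiv_pres_rel pres_rel_inverse[OF u(1)]])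
    thus ?thesis using i unfolding carrier by blast
  qed
qed


section \<open>The associated group of a quandle\<close>

text \<open>The generator \<open>e\<^sub>x\<close> is the class of the word \<open>[(x, True)]\<close>; the relations are
  \<open>e\<^bsub>x \<triangleright> y\<^esub> = e\<^sub>y\<^sup>-\<^sup>1 e\<^sub>x e\<^sub>y\<close>.\<close>

definition associated_group :: "'a set \<Rightarrow> ('a \<Rightarrow> 'a \<Rightarrow> 'a) \<Rightarrow> 'a word set monoid" where
  "associated_group Q op = presented_group Q
    {([(op x y, True)], [(y, False), (x, True), (y, True)]) | x y. x \<in> Q \<and> y \<in> Q}"


section \<open>Residually finite groups\<close>

text \<open>
  Every non-trivial element survives in some finite group. The finite groups have carriers of
  natural numbers, since a type cannot be quantified existentially; every finite group is
  isomorphic to one of these (see \<open>residually_finiteI\<close> and \<open>residually_finite_iff_normal\<close>).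
\<close>

definition residually_finite :: "('a, 'm) monoid_scheme \<Rightarrow> bool" where
  "residually_finite G \<longleftrightarrow> group G \<and>
    (\<forall>g \<in> carrier G. g \<noteq> \<one>\<^bsub>G\<^esub> \<longrightarrow>
      (\<exists>(F :: nat monoid) \<phi>. group F \<and> finite (carrier F) \<and> \<phi> \<in> hom G F \<and> \<phi> g \<noteq> \<one>\<^bsub>F\<^esub>))"

lemma finite_group_nat:
  fixes H :: "('b, 'm) monoid_scheme"
  assumes "group H" "finite (carrier H)"
  obtains F :: "nat monoid" and f where "group F" "finite (carrier F)" "f \<in> iso H F"
proof -
  interpret H: group H by fact
  obtain f :: "'b \<Rightarrow> nat" where inj: "inj_on f (carrier H)"
    using finite_imp_inj_to_nat_seg[OF assms(2)] by blast
  define F :: "nat monoid" where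
    "F = \<lparr>carrier = f ` carrier H,
      mult = (\<lambda>a b. f (inv_into (carrier H) f a \<otimes>\<^bsub>H\<^esub> inv_into (carrier H) f b)),
      one = f \<one>\<^bsub>H\<^esub>\<rparr>"
  have f: "f \<in> iso H F"
    using inj by (auto simp: iso_def hom_def bij_betw_def F_def)
  have "f \<one>\<^bsub>H\<^esub> = \<one>\<^bsub>F\<^esub>"
    by (simp add: F_def)
  hence "group F"
    using H.iso_imp_img_group[OF f] by (simp add: F_def)
  thus thesis
    using that f assms(2) by (simp add: F_def)
qed

lemma residually_finiteI:
  fixes G :: "('a, 'm) monoid_scheme"
  assumes "group G"
    and "\<And>g. \<lbrakk>g \<in> carrier G; g \<noteq> \<one>\<^bsub>G\<^esub>\<rbrakk> \<Longrightarrow>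
      \<exists>(H :: 'b monoid) \<phi>. group H \<and> finite (carrier H) \<and> \<phi> \<in> hom G H \<and> \<phi> g \<noteq> \<one>\<^bsub>H\<^esub>"
  shows "residually_finite G"
  unfolding residually_finite_def
proof (intro conjI ballI impI)
  show "group G" by fact
  fix g assume g: "g \<in> carrier G" "g \<noteq> \<one>\<^bsub>G\<^esub>"
  obtain H :: "'b monoid" and \<phi> where H: "group H" "finite (carrier H)" "\<phi> \<in> hom G H"
    "\<phi> g \<noteq> \<one>\<^bsub>H\<^esub>"
    using assms(2)[OF g] by blast
  obtain F :: "nat monoid" and f where F: "group F" "finite (carrier F)" "f \<in> iso H F"
    using finite_group_nat[OF H(1,2)] by blast
  have f: "f \<in> hom H F" "inj_on f (carrier H)"
    using F(3) by (auto simp: iso_def bij_betw_def)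
  have "f \<one>\<^bsub>H\<^esub> = \<one>\<^bsub>F\<^esub>"
    by (rule hom_one[OF f(1) H(1) F(1)])
  moreover have "\<phi> g \<in> carrier H" "\<one>\<^bsub>H\<^esub> \<in> carrier H"
    using H(1,3) g(1) by (auto simp: hom_def group.is_monoid monoid.one_closed)
  ultimately have "(f \<circ> \<phi>) g \<noteq> \<one>\<^bsub>F\<^esub>"
    using f(2) H(4) by (metis comp_apply inj_onD)
  moreover have "f \<circ> \<phi> \<in> hom G F"
    using H(3) f(1) by (rule hom_compose)
  ultimately show "\<exists>(F :: nat monoid) \<phi>. group F \<and> finite (carrier F) \<and> \<phi> \<in> hom G F \<and> \<phi> g \<noteq> \<one>\<^bsub>F\<^esub>"
    using F(1,2) by blast
qed

lemma residually_finite_iff_normal: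
  "residually_finite G \<longleftrightarrow> group G \<and>
    (\<forall>g \<in> carrier G. g \<noteq> \<one>\<^bsub>G\<^esub> \<longrightarrow>
      (\<exists>N. N \<lhd> G \<and> finite (carrier (G Mod N)) \<and> g \<notin> N))"
proof (intro iffI conjI ballI impI)
  assume G: "residually_finite G"
  thus "group G" by (simp add: residually_finite_def)
  fix g assume g: "g \<in> carrier G" "g \<noteq> \<one>\<^bsub>G\<^esub>"
  obtain F :: "nat monoid" and \<phi> where F: "group F" "finite (carrier F)" "\<phi> \<in> hom G F"
    "\<phi> g \<noteq> \<one>\<^bsub>F\<^esub>"
    using G g unfolding residually_finite_def by blast
  interpret group_hom G F \<phi>
    using \<open>group G\<close> F by (simp add: group_hom_def group_hom_axioms_def)
  have "(\<lambda>C. the_elem (\<phi> ` C)) ` carrier (G Mod kernel G F \<phi>) \<subseteq> carrier F"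
    using FactGroup_hom by (auto simp: hom_def)
  hence "finite (carrier (G Mod kernel G F \<phi>))"
    using FactGroup_inj_on F(2) by (metis finite_imageD finite_subset)
  thus "\<exists>N. N \<lhd> G \<and> finite (carrier (G Mod N)) \<and> g \<notin> N"
    using normal_kernel F(4) by (auto simp: kernel_def)
next
  assume *: "group G \<and> (\<forall>g \<in> carrier G. g \<noteq> \<one>\<^bsub>G\<^esub> \<longrightarrow>
      (\<exists>N. N \<lhd> G \<and> finite (carrier (G Mod N)) \<and> g \<notin> N))"
  show "residually_finite G"
  proof (rule residually_finiteI)
    show "group G" using * by blast
    fix g assume g: "g \<in> carrier G" "g \<noteq> \<one>\<^bsub>G\<^esub>"
    then obtain N where N: "N \<lhd> G" "finite (carrier (G Mod N))" "g \<notin> N"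
      using * by blast
    interpret normal N G by fact
    have "N #>\<^bsub>G\<^esub> g \<noteq> \<one>\<^bsub>G Mod N\<^esub>"
      using N(3) g(1) rcos_self[OF g(1) is_subgroup] by (auto simp: FactGroup_def)
    thus "\<exists>(H :: 'a set monoid) \<phi>. group H \<and> finite (carrier H) \<and> \<phi> \<in> hom G H \<and> \<phi> g \<noteq> \<one>\<^bsub>H\<^esub>"
      using r_coset_hom_Mod factorgroup_is_group N(2) by blast
  qed
qed

end

theory Submission
  imports Defs "HOL-Algebra.Elementary_Groups"
begin

text \<open>
  Let \<open>G\<close> be the associated group of a finite quandle. Its generators form a finite set which
  conjugation by generators maps into itself, so some positive power of each generator commutes with all
  the others, and there is one exponent \<open>n > 0\<close> for which every \<open>e\<^sub>x\<^sup>n\<close> is central. Let \<open>A\<close> be the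
  central subgroup generated by these powers. Two facts decide the matter.

  \<^item> \<open>G/A\<close> is finite (\<open>finite_quotient_by_powers\<close>). This is the argument of Dietzmann's lemma:
    modulo \<open>A\<close> every element is a positive word in the generators, in a long word some letter
    occurs \<open>n\<close> times, and these occurrences can be collected at the front, at the price of
    conjugating the letters that they pass. There they form an element of \<open>A\<close>, so every element
    is represented modulo \<open>A\<close> by a word of bounded length.
  \<^item> Homomorphisms \<open>G \<rightarrow> \<int>\<close> separate the elements of \<open>A\<close> from the identity
    (\<open>trivial_if_dual_homs_vanish\<close>). For \<open>c\<close> among the powers, the exponent sum \<open>\<psi>\<^sub>c\<close> over those
    generators \<open>e\<^sub>x\<close> with \<open>e\<^sub>x\<^sup>n = c\<close> respects the defining relations, because conjugate
    generators have the same \<open>n\<close>-th power (\<open>hom_counting_power\<close>). Since \<open>\<psi>\<^sub>c(d)\<close> is \<open>n\<close> for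
    \<open>d = c\<close> and \<open>0\<close> for the other powers \<open>d\<close>, the powers form a basis of \<open>A\<close>, and an element of
    \<open>A\<close> is determined by its values under the \<open>\<psi>\<^sub>c\<close>.

  A non-trivial element outside \<open>A\<close> thus survives in the finite group \<open>G/A\<close>, and one inside
  \<open>A\<close> survives in \<open>\<int>\<close> and from there in some \<open>\<int>/m\<close>.
\<close>


section \<open>Separating elements by homomorphisms into residually finite groups\<close>

lemma residually_finite_if_finite:
  assumes "group G" and "finite (carrier G)"
  shows "residually_finite G"
proof -
  obtain F :: "nat monoid" and f where F: "group F" "finite (carrier F)" "f \<in> iso G F"
    using finite_group_nat[OF assms] by blast
  have f: "f \<in> hom G F" "inj_on f (carrier G)"
    using F(3) by (auto simp: iso_def bij_betw_def)
  have "f g \<noteq> \<one>\<^bsub>F\<^esub>" if "g \<in> carrier G" "g \<noteq> \<one>\<^bsub>G\<^esub>" for g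
    using that f hom_one[OF f(1) assms(1) F(1)] assms(1)
    by (metis group.is_monoid inj_onD monoid.one_closed)
  thus ?thesis
    unfolding residually_finite_def using assms(1) F(1,2) f(1) by blast
qed

lemma residually_finite_integer_group: "residually_finite integer_group"
proof (rule residually_finiteI)
  show "group integer_group" by simp
  fix g :: int
  assume g: "g \<noteq> \<one>\<^bsub>integer_group\<^esub>"
  \<comment> \<open>Any modulus exceeding \<open>\<bar>g\<bar>\<close> keeps \<open>g\<close> non-zero.\<close>
  define m where "m = nat \<bar>g\<bar> + 1"
  have m: "m > 0" "int m = \<bar>g\<bar> + 1" by (simp_all add: m_def)
  have "(\<lambda>k. k mod int m) \<in> hom integer_group (integer_mod_group m)"
    using m(1) by (auto simp: hom_def carrier_integer_mod_group mod_add_eq)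
  moreover have "g mod int m \<noteq> \<one>\<^bsub>integer_mod_group m\<^esub>"
  proof
    assume "g mod int m = \<one>\<^bsub>integer_mod_group m\<^esub>"
    hence "int m dvd g" by auto
    hence "int m \<le> \<bar>g\<bar>" using g dvd_imp_le_int[of g "int m"] by simp
    thus False using m(2) by simp
  qed
  moreover have "finite (carrier (integer_mod_group m))"
    using m(1) by (simp add: carrier_integer_mod_group)
  ultimately show "\<exists>(H :: int monoid) \<phi>. group H \<and> finite (carrier H) \<and>
      \<phi> \<in> hom integer_group H \<and> \<phi> g \<noteq> \<one>\<^bsub>H\<^esub>"
    using group_integer_mod_group by blast
qed

text \<open>
  For residual finiteness of \<open>G\<close> it is enough to separate each element in a residually finite
  group, which may depend on the element.
\<close>

lemma separated_by_hom_to_residually_finite: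
  assumes "residually_finite H" and "\<psi> \<in> hom G H" and "g \<in> carrier G" and "\<psi> g \<noteq> \<one>\<^bsub>H\<^esub>"
  shows "\<exists>(F :: nat monoid) \<phi>. group F \<and> finite (carrier F) \<and> \<phi> \<in> hom G F \<and> \<phi> g \<noteq> \<one>\<^bsub>F\<^esub>"
proof -
  have "\<psi> g \<in> carrier H" using assms(2,3) by (auto simp: hom_def)
  then obtain F :: "nat monoid" and \<phi> where F: "group F" "finite (carrier F)" "\<phi> \<in> hom H F"
    "\<phi> (\<psi> g) \<noteq> \<one>\<^bsub>F\<^esub>"
    using assms(1,4) unfolding residually_finite_def by blast
  have "\<phi> \<circ> \<psi> \<in> hom G F" using assms(2) F(3) by (rule hom_compose)
  thus ?thesis using F by (metis comp_apply)
qed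


section \<open>Central elements\<close>

definition center :: "('a, 'm) monoid_scheme \<Rightarrow> 'a set" where
  "center G = {z \<in> carrier G. \<forall>g \<in> carrier G. z \<otimes>\<^bsub>G\<^esub> g = g \<otimes>\<^bsub>G\<^esub> z}"

context group
begin

lemma centerD:
  assumes "z \<in> center G"
  shows "z \<in> carrier G" and "\<And>g. g \<in> carrier G \<Longrightarrow> z \<otimes> g = g \<otimes> z"
  using assms by (auto simp: center_def)

lemma conj_central:
  assumes "z \<in> center G" and "g \<in> carrier G"
  shows "inv g \<otimes> z \<otimes> g = z"
  using assms centerD[OF assms(1)] by (metis inv_closed l_inv m_assoc r_one)

lemma inv_cancel_left:
  assumes "y \<in> carrier G" and "z \<in> carrier G"
  shows "y \<otimes> (inv y \<otimes> z) = z" and "inv y \<otimes> (y \<otimes> z) = z"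
  using assms by (simp_all flip: m_assoc)

lemma pow_conj:
  assumes "x \<in> carrier G" and "y \<in> carrier G"
  shows "(inv y \<otimes> x \<otimes> y) [^] (n::nat) = inv y \<otimes> x [^] n \<otimes> y"
proof (induction n)
  case 0
  show ?case using assms by simp
next
  case (Suc n)
  thus ?case using assms by (simp add: m_assoc inv_cancel_left)
qed

lemma commutes_generate:
  assumes z: "z \<in> carrier G" and E: "E \<subseteq> carrier G"
    and comm: "\<And>x. x \<in> E \<Longrightarrow> z \<otimes> x = x \<otimes> z"
    and g: "g \<in> generate G E"
  shows "z \<otimes> g = g \<otimes> z"
  using g
proof (induction rule: generate.induct)
  case one
  show ?case using z by simp
next
  case (incl h)
  thus ?case by (rule comm)
next
  case (inv h)
  have h: "h \<in> carrier G" using inv E by blast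
  have "z \<otimes> inv h = inv h \<otimes> (h \<otimes> z) \<otimes> inv h"
    using z h by (simp add: m_assoc inv_solve_left)
  also have "\<dots> = inv h \<otimes> z"
    using z h comm[OF inv] by (metis inv_closed m_assoc m_closed r_inv r_one)
  finally show ?case .
next
  case (eng h1 h2)
  have h: "h1 \<in> carrier G" "h2 \<in> carrier G"
    using eng.hyps generate_in_carrier[OF E] by blast+
  show ?case using z h eng.IH by (metis m_assoc)
qed

lemma center_if_commutes_generators:
  assumes "carrier G = generate G E" and "E \<subseteq> carrier G" and "z \<in> carrier G"
    and "\<And>x. x \<in> E \<Longrightarrow> z \<otimes> x = x \<otimes> z"
  shows "z \<in> center G"
  using assms commutes_generate[OF assms(3,2,4)] by (auto simp: center_def)

lemma normal_generate_central:
  assumes "C \<subseteq> center G"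
  shows "generate G C \<lhd> G"
proof (rule normal_generateI)
  show "C \<subseteq> carrier G" using assms centerD by blast
  fix h g assume h: "h \<in> C" and g: "g \<in> carrier G"
  have "h \<in> center G" using h assms by blast
  hence "g \<otimes> h \<otimes> inv g = h"
    using conj_central[of h "inv g"] g by simp
  thus "g \<otimes> h \<otimes> inv g \<in> C" using h by simp
qed

lemma generate_insert_central:
  assumes c: "c \<in> center G" and D: "D \<subseteq> carrier G"
    and a: "a \<in> generate G (insert c D)"
  shows "\<exists>(k :: int). \<exists>b \<in> generate G D. a = c [^] k \<otimes> b"
  using a
proof (induction rule: generate.induct)
  case one
  show ?case
    by (rule exI[of _ 0], rule bexI[of _ \<one>]) (simp_all add: generate.one)
next
  case (incl h)
  show ?case
  proof (cases "h = c")
    case True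
    thus ?thesis
      using centerD(1)[OF c] by (intro exI[of _ 1] bexI[of _ \<one>]) (simp_all add: generate.one)
  next
    case False
    thus ?thesis
      using incl D by (intro exI[of _ 0] bexI[of _ h]) (auto intro: generate.incl)
  qed
next
  case (inv h)
  show ?case
  proof (cases "h = c")
    case True
    thus ?thesis
      using centerD(1)[OF c]
      by (intro exI[of _ "-1"] bexI[of _ \<one>]) (simp_all add: generate.one int_pow_neg)
  next
    case False
    thus ?thesis
      using inv D by (intro exI[of _ 0] bexI[of _ "inv h"]) (auto intro: generate.inv)
  qed
next
  case (eng h1 h2)
  obtain k l :: int and b1 b2 where
    b: "b1 \<in> generate G D" "b2 \<in> generate G D" and h: "h1 = c [^] k \<otimes> b1" "h2 = c [^] l \<otimes> b2"
    using eng.IH by blast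
  have car: "c \<in> carrier G" "b1 \<in> carrier G" "b2 \<in> carrier G"
    using centerD(1)[OF c] b generate_in_carrier[OF D] by blast+
  have "c [^] l \<in> generate G {c}" using generate_pow[OF car(1)] by blast
  hence "b1 \<otimes> c [^] l = c [^] l \<otimes> b1"
    using commutes_generate[of b1 "{c}"] car centerD(2)[OF c] by simp
  hence "h1 \<otimes> h2 = c [^] (k + l) \<otimes> (b1 \<otimes> b2)"
    unfolding h using car by (simp add: int_pow_mult m_assoc) (simp flip: m_assoc)
  thus ?case using generate.eng[OF b] by blast
qed

text \<open>
  The homomorphisms \<open>\<psi> c\<close> are, up to the factor \<open>n\<close>, dual to the central elements \<open>c\<close>: they read
  off the exponents in a product of powers of these elements. In the induction on \<open>C\<close>, the
  homomorphism of the new element \<open>c\<close> is trivial on the subgroup generated by the others, so its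
  vanishing forces the exponent of \<open>c\<close> to be \<open>0\<close>, and the remaining factor lies in that
  subgroup.
\<close>

lemma trivial_if_dual_homs_vanish:
  assumes "finite C" and "C \<subseteq> center G" and "n \<noteq> 0"
    and "\<And>c. c \<in> C \<Longrightarrow> \<psi> c \<in> hom G integer_group"
    and "\<And>c d. \<lbrakk>c \<in> C; d \<in> C\<rbrakk> \<Longrightarrow> \<psi> c d = (if d = c then n else 0)"
    and "a \<in> generate G C" and "\<And>c. c \<in> C \<Longrightarrow> \<psi> c a = 0"
  shows "a = \<one>"
  using assms
proof (induction C arbitrary: a rule: finite_induct)
  case empty
  thus ?case by (simp add: generate_empty)
next
  case (insert c D)
  have c: "c \<in> center G" "c \<in> carrier G" and D: "D \<subseteq> center G" "D \<subseteq> carrier G"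
    using insert.prems(1) centerD by blast+
  obtain k :: int and b where b: "b \<in> generate G D" and a: "a = c [^] k \<otimes> b"
    using generate_insert_central[OF c(1) D(2) insert.prems(5)] by blast
  have bc: "b \<in> carrier G" using b generate_in_carrier[OF D(2)] by blast
  have hom: "group_hom G integer_group (\<psi> d)" if "d \<in> insert c D" for d
    using insert.prems(3)[OF that] by (simp add: group_hom_def group_hom_axioms_def)
  have \<psi>a: "\<psi> d a = k * \<psi> d c + \<psi> d b" if "d \<in> insert c D" for d
  proof -
    interpret group_hom G integer_group "\<psi> d" by (rule hom[OF that])
    show ?thesis unfolding a using c bc by (simp add: hom_int_pow)
  qed
  interpret c: group_hom G integer_group "\<psi> c" by (rule hom) simp
  have "D \<subseteq> kernel G integer_group (\<psi> c)"
    using D(2) insert.hyps(2) insert.prems(4)[of c] by (auto simp: kernel_def)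
  hence "generate G D \<subseteq> kernel G integer_group (\<psi> c)"
    by (rule generate_subgroup_incl) (rule c.subgroup_kernel)
  hence "\<psi> c b = 0" using b by (auto simp: kernel_def)
  hence "k * n = 0"
    using \<psi>a[of c] insert.prems(4)[of c c] insert.prems(6)[of c] by simp
  hence k: "k = 0" using insert.prems(2) by simp
  have "b = \<one>"
  proof (rule insert.IH[OF D(1) insert.prems(2) _ _ b])
    fix d assume "d \<in> D"
    thus "\<psi> d b = 0" using \<psi>a[of d] k insert.prems(6)[of d] by simp
  qed (use insert.prems(3,4) in auto)
  thus ?case using a k by simp
qed

end


section \<open>Groups generated by a finite set of elements closed under conjugation\<close>

locale finite_conjugation_closed_generators = group G for G (structure) +
  fixes E
  assumes finite_E: "finite E"
    and E_carrier: "E \<subseteq> carrier G"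
    and conj_E: "\<lbrakk>x \<in> E; y \<in> E\<rbrakk> \<Longrightarrow> inv y \<otimes> x \<otimes> y \<in> E"
    and generated: "carrier G = generate G E"
begin

lemma conj_pow_E:
  assumes x: "x \<in> E" and y: "y \<in> E"
  shows "inv (y [^] (k::nat)) \<otimes> x \<otimes> y [^] k \<in> E"
proof (induction k)
  case 0
  show ?case using x E_carrier by auto
next
  case (Suc k)
  have car: "x \<in> carrier G" "y \<in> carrier G" using x y E_carrier by blast+
  have "inv (y [^] Suc k) \<otimes> x \<otimes> y [^] Suc k = inv y \<otimes> (inv (y [^] k) \<otimes> x \<otimes> y [^] k) \<otimes> y"
    using car by (simp add: inv_mult_group m_assoc)
  thus ?case using conj_E[OF Suc.IH y] by simp
qed

text \<open>
  The conjugates of \<open>x\<close> by the powers of \<open>y\<close> all lie in the finite set \<open>E\<close>, so two of them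
  coincide.
\<close>

lemma pow_commutes_E:
  assumes x: "x \<in> E" and y: "y \<in> E"
  shows "\<exists>m>0. y [^] (m::nat) \<otimes> x = x \<otimes> y [^] m"
proof -
  have car: "x \<in> carrier G" "y \<in> carrier G" using x y E_carrier by blast+
  define f where "f k = inv (y [^] k) \<otimes> x \<otimes> y [^] k" for k :: nat
  have "range f \<subseteq> E" using conj_pow_E[OF x y] by (auto simp: f_def)
  hence "\<not> inj f" using finite_E finite_subset infinite_UNIV_nat finite_imageD by metis
  then obtain i j where "f i = f j" "i < j"
    by (metis inj_onI linorder_neqE_nat)
  then obtain m where m: "m > 0" "f i = f (i + m)"
    by (metis less_imp_add_positive)
  have "f (i + m) = inv (y [^] i) \<otimes> (inv (y [^] m) \<otimes> x \<otimes> y [^] m) \<otimes> y [^] i"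
    using car by (simp add: f_def nat_pow_mult[symmetric] add.commute[of i] inv_mult_group m_assoc)
  hence "x = inv (y [^] m) \<otimes> x \<otimes> y [^] m"
    using m(2) car by (simp add: f_def)
  hence "y [^] m \<otimes> x = x \<otimes> y [^] m"
    using car by (metis inv_closed inv_solve_left m_assoc m_closed nat_pow_closed)
  thus ?thesis using m(1) by blast
qed

lemma common_central_exponent: "\<exists>n>0. \<forall>y\<in>E. y [^] (n::nat) \<in> center G"
proof -
  have "\<forall>p\<in>E \<times> E. \<exists>k::nat. k > 0 \<and> snd p [^] k \<otimes> fst p = fst p \<otimes> snd p [^] k"
    using pow_commutes_E by auto
  from bchoice[OF this] obtain m :: "'a \<times> 'a \<Rightarrow> nat" where
    m: "\<And>x y. \<lbrakk>x \<in> E; y \<in> E\<rbrakk> \<Longrightarrow>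
      m (x, y) > 0 \<and> y [^] m (x, y) \<otimes> x = x \<otimes> y [^] m (x, y)"
    by force
  \<comment> \<open>A common multiple of the exponents that work for the single pairs.\<close>
  define n where "n = prod m (E \<times> E)"
  have "n > 0" using m by (auto simp: n_def intro!: prod_pos)
  moreover have "y [^] n \<in> center G" if y: "y \<in> E" for y
  proof (rule center_if_commutes_generators[OF generated E_carrier])
    show yc: "y [^] n \<in> carrier G" using y E_carrier by auto
    fix x assume x: "x \<in> E"
    have "m (x, y) dvd n"
      unfolding n_def using x y finite_E by (intro dvd_prodI) auto
    then obtain q where q: "n = m (x, y) * q" by (rule dvdE)
    have "y [^] n = (y [^] m (x, y)) [^] q"
      using y E_carrier by (auto simp: q nat_pow_pow)
    thus "y [^] n \<otimes> x = x \<otimes> y [^] n"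
      using group_commutes_pow[of "y [^] m (x, y)" x q] m[OF x y] x y E_carrier by auto
  qed
  ultimately show ?thesis by blast
qed

abbreviation list_product :: "'a list \<Rightarrow> 'a" where
  "list_product xs \<equiv> foldr (\<otimes>) xs \<one>"

lemma list_product_closed: "set xs \<subseteq> E \<Longrightarrow> list_product xs \<in> carrier G"
  using E_carrier by (induction xs) auto

text \<open>
  Moving \<open>x\<close> to the left past a letter \<open>a\<close> replaces \<open>a\<close> by a conjugate, which is again a letter;
  the length of the word stays the same.
\<close>

lemma collect_letter:
  assumes x: "x \<in> E" and "set xs \<subseteq> E" and "k \<le> count_list xs x"
  shows "\<exists>ys. set ys \<subseteq> E \<and> length ys + k = length xs \<and>
    list_product xs = x [^] k \<otimes> list_product ys"
  using assms(2,3)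
proof (induction xs arbitrary: k)
  case Nil
  thus ?case by simp
next
  case (Cons a xs)
  have a: "a \<in> E" and xs: "set xs \<subseteq> E" using Cons.prems(1) by auto
  have car: "x \<in> carrier G" "a \<in> carrier G" using x a E_carrier by blast+
  consider "k = 0" | l where "a = x" "k = Suc l" | "a \<noteq> x"
    by (cases k) auto
  thus ?case
  proof cases
    case 1
    thus ?thesis
      using Cons.prems(1) list_product_closed[of "a # xs"] by (intro exI[of _ "a # xs"]) simp
  next
    case 2
    then obtain ys where ys: "set ys \<subseteq> E" "length ys + l = length xs"
      "list_product xs = x [^] l \<otimes> list_product ys"
      using Cons.IH[OF xs, of l] Cons.prems(2) by auto
    have "x \<otimes> x [^] l = x [^] k"
      using car 2(2) group_commutes_pow[of x x l] by simp
    hence "list_product (a # xs) = x [^] k \<otimes> list_product ys"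
      using ys car 2(1) list_product_closed[OF ys(1)] by (simp flip: m_assoc)
    thus ?thesis using ys 2(2) by auto
  next
    case 3
    then obtain ys where ys: "set ys \<subseteq> E" "length ys + k = length xs"
      "list_product xs = x [^] k \<otimes> list_product ys"
      using Cons.IH[OF xs, of k] Cons.prems(2) by auto
    define a' where "a' = inv (x [^] k) \<otimes> a \<otimes> x [^] k"
    have a': "a' \<in> E" unfolding a'_def by (rule conj_pow_E[OF a x])
    have "a \<otimes> x [^] k = x [^] k \<otimes> a'"
      using car by (simp add: a'_def m_assoc inv_cancel_left)
    hence "list_product (a # xs) = x [^] k \<otimes> list_product (a' # ys)"
      using ys car a' E_carrier list_product_closed[OF ys(1)]
      by (simp add: subset_iff flip: m_assoc)
    thus ?thesis using ys a' by (intro exI[of _ "a' # ys"]) simp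
  qed
qed

context
  fixes n :: nat
  assumes n_pos: "n > 0"
    and central: "\<And>x. x \<in> E \<Longrightarrow> x [^] n \<in> center G"
begin

abbreviation "powers \<equiv> (\<lambda>x. x [^] n) ` E"

lemma powers_carrier: "powers \<subseteq> carrier G"
  using E_carrier by auto

text \<open>
  A word of more than \<open>card E * n\<close> letters contains some letter at least \<open>n\<close> times. Collecting
  \<open>n\<close> copies of it at the front splits off an element of the subgroup and shortens the word.
\<close>

lemma bounded_list_product_mod_powers:
  assumes "set xs \<subseteq> E"
  shows "\<exists>ys. set ys \<subseteq> E \<and> length ys \<le> card E * n \<and>
    (\<exists>a \<in> generate G powers. list_product xs = a \<otimes> list_product ys)"
  using assms
proof (induction xs rule: length_induct)
  case (1 xs)
  show ?case
  proof (cases "length xs \<le> card E * n")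
    case True
    thus ?thesis
      using 1(2) list_product_closed[OF 1(2)] generate.one[of G powers]
      by (intro exI[of _ xs]) (auto intro!: bexI[of _ \<one>])
  next
    case False
    have "\<exists>x\<in>E. n \<le> count_list xs x"
    proof (rule ccontr)
      assume "\<not> ?thesis"
      hence "sum (count_list xs) E \<le> card E * n"
        by (intro sum_bounded_above[where K = n, simplified]) auto
      thus False using False sum_count_set[OF 1(2) finite_E] by simp
    qed
    then obtain x ys where x: "x \<in> E" and ys: "set ys \<subseteq> E" "length ys + n = length xs"
      "list_product xs = x [^] n \<otimes> list_product ys"
      using collect_letter[OF _ 1(2)] by blast
    have "length ys < length xs" using ys(2) n_pos by simp
    then obtain zs a where zs: "set zs \<subseteq> E" "length zs \<le> card E * n"
      and a: "a \<in> generate G powers" "list_product ys = a \<otimes> list_product zs"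
      using 1(1) ys(1) by blast
    have "x [^] n \<in> generate G powers" using x by (auto intro: generate.incl)
    hence xa: "x [^] n \<otimes> a \<in> generate G powers" using a(1) by (rule generate.eng)
    have "a \<in> carrier G" using a(1) generate_in_carrier[OF powers_carrier] by blast
    hence "list_product xs = x [^] n \<otimes> a \<otimes> list_product zs"
      using ys(3) a(2) x E_carrier list_product_closed[OF zs(1)] by (auto simp: m_assoc)
    thus ?thesis using zs xa by blast
  qed
qed

lemma list_product_append:
  assumes "set xs \<subseteq> E" and "set ys \<subseteq> E"
  shows "list_product (xs @ ys) = list_product xs \<otimes> list_product ys"
  using assms(1)
proof (induction xs)
  case Nil
  show ?case using list_product_closed[OF assms(2)] by simp
next
  case (Cons x xs)
  thus ?case
    using list_product_closed[of xs] list_product_closed[OF assms(2)] E_carrier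
    by (auto simp: m_assoc)
qed

lemma list_product_replicate:
  assumes "x \<in> E"
  shows "list_product (replicate k x) = x [^] k"
proof (induction k)
  case (Suc k)
  thus ?case using assms E_carrier group_commutes_pow[of x x k] by auto
qed simp

text \<open>
  Negative exponents are avoided by writing the inverse of a generator \<open>h\<close> as the product of
  \<open>inv (h [^] n)\<close> and \<open>h [^] (n - 1)\<close>.
\<close>

lemma list_product_mod_powers:
  assumes "g \<in> carrier G"
  shows "\<exists>xs. set xs \<subseteq> E \<and> (\<exists>a \<in> generate G powers. g = a \<otimes> list_product xs)"
proof -
  have "g \<in> generate G E" using assms generated by simp
  thus ?thesis
  proof (induction rule: generate.induct)
    case one
    show ?case
      by (rule exI[of _ "[]"]) (auto intro!: bexI[of _ \<one>] generate.one)
  next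
    case (incl h)
    thus ?case
      using E_carrier by (intro exI[of _ "[h]"]) (auto intro!: bexI[of _ \<one>] generate.one)
  next
    case (inv h)
    have h: "h \<in> carrier G" using inv E_carrier by blast
    have "h [^] n = h [^] (n - 1) \<otimes> h"
      using n_pos by (cases n) auto
    hence "inv h = inv (h [^] n) \<otimes> h [^] (n - 1)"
      using h by (simp add: inv_mult_group m_assoc)
    moreover have "inv (h [^] n) \<in> generate G powers" using inv by (auto intro: generate.inv)
    ultimately show ?case
      using inv list_product_replicate[OF inv]
      by (intro exI[of _ "replicate (n - 1) h"]) auto
  next
    case (eng g h)
    obtain xs ys a b where xs: "set xs \<subseteq> E" "set ys \<subseteq> E"
      and a: "a \<in> generate G powers" "b \<in> generate G powers"
      and eq: "g = a \<otimes> list_product xs" "h = b \<otimes> list_product ys"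
      using eng.IH by blast
    have car: "a \<in> carrier G" "b \<in> carrier G" "list_product xs \<in> carrier G"
      "list_product ys \<in> carrier G"
      using a generate_in_carrier[OF powers_carrier] xs list_product_closed by blast+
    have "list_product xs \<otimes> b = b \<otimes> list_product xs"
    proof (rule commutes_generate[OF car(3) powers_carrier _ a(2)])
      fix p assume "p \<in> powers"
      hence "p \<in> center G" using central by blast
      thus "list_product xs \<otimes> p = p \<otimes> list_product xs"
        by (rule centerD(2)[OF _ car(3), symmetric])
    qed
    hence "list_product xs \<otimes> (b \<otimes> list_product ys) = b \<otimes> (list_product xs \<otimes> list_product ys)"
      using car by (simp flip: m_assoc)
    hence "g \<otimes> h = (a \<otimes> b) \<otimes> list_product (xs @ ys)"
      unfolding eq list_product_append[OF xs] using car by (simp add: m_assoc)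
    thus ?case using xs generate.eng[OF a] by (intro exI[of _ "xs @ ys"]) auto
  qed
qed

lemma finite_quotient_by_powers: "finite (carrier (G Mod generate G powers))"
proof -
  let ?A = "generate G powers"
  let ?W = "{ys. set ys \<subseteq> E \<and> length ys \<le> card E * n}"
  have "carrier (G Mod ?A) \<subseteq> (\<lambda>ys. ?A #> list_product ys) ` ?W"
  proof
    fix K assume "K \<in> carrier (G Mod ?A)"
    then obtain g where g: "g \<in> carrier G" "K = ?A #> g"
      by (auto simp: FactGroup_def RCOSETS_def)
    obtain xs a where xs: "set xs \<subseteq> E" and a: "a \<in> ?A" "g = a \<otimes> list_product xs"
      using list_product_mod_powers[OF g(1)] by blast
    obtain ys b where ys: "set ys \<subseteq> E" "length ys \<le> card E * n"
      and b: "b \<in> ?A" "list_product xs = b \<otimes> list_product ys"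
      using bounded_list_product_mod_powers[OF xs] by blast
    have car: "a \<in> carrier G" "b \<in> carrier G" "list_product ys \<in> carrier G"
      using a b generate_in_carrier[OF powers_carrier] ys list_product_closed by blast+
    have "g = (a \<otimes> b) \<otimes> list_product ys" using a(2) b(2) car by (simp add: m_assoc)
    hence "g \<in> ?A #> list_product ys"
      using generate.eng[OF a(1) b(1)] by (auto simp: r_coset_def)
    hence "K = ?A #> list_product ys"
      unfolding g(2)
      by (rule repr_independence[OF _ car(3) generate_is_subgroup[OF powers_carrier],
          symmetric])
    thus "K \<in> (\<lambda>ys. ?A #> list_product ys) ` ?W" using ys by blast
  qed
  thus ?thesis by (rule finite_subset) (intro finite_imageI finite_lists_length_le finite_E)
qed

end

end


section \<open>The universal property of a presentation\<close>

text \<open>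
  The image of a word under the homomorphism from the free group that sends the generator
  \<open>s\<close> to \<open>f s\<close>.
\<close>

definition word_value :: "('b, 'm) monoid_scheme \<Rightarrow> ('a \<Rightarrow> 'b) \<Rightarrow> 'a word \<Rightarrow> 'b" where
  "word_value H f u =
    foldr (\<lambda>(s, b) h. (if b then f s else inv\<^bsub>H\<^esub> f s) \<otimes>\<^bsub>H\<^esub> h) u \<one>\<^bsub>H\<^esub>"

lemma word_value_simps [simp]:
  "word_value H f [] = \<one>\<^bsub>H\<^esub>"
  "word_value H f ((s, b) # u) = (if b then f s else inv\<^bsub>H\<^esub> f s) \<otimes>\<^bsub>H\<^esub> word_value H f u"
  by (simp_all add: word_value_def)

context group
begin

lemma word_value_closed:
  assumes "f \<in> S \<rightarrow> carrier G" and "u \<in> words S"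
  shows "word_value G f u \<in> carrier G"
  using assms(2,1)
  by (induction u rule: lists.induct) (auto dest: funcset_mem intro!: m_closed)

lemma word_value_append:
  assumes f: "f \<in> S \<rightarrow> carrier G" and "u \<in> words S" and v: "v \<in> words S"
  shows "word_value G f (u @ v) = word_value G f u \<otimes> word_value G f v"
  using assms(2)
proof (induction u rule: lists.induct)
  case Nil
  show ?case using word_value_closed[OF f v] by simp
next
  case (Cons a u)
  thus ?case
    using word_value_closed[OF f v] word_value_closed[OF f Cons(2)] f
    by (cases a) (auto simp: m_assoc Pi_iff)
qed

lemma word_value_cong_pres_rel:
  assumes f: "f \<in> S \<rightarrow> carrier G"
    and R: "\<And>u v. \<lbrakk>(u, v) \<in> R; u \<in> words S; v \<in> words S\<rbrakk>
      \<Longrightarrow> word_value G f u = word_value G f v"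
    and uv: "(u, v) \<in> pres_rel S R"
  shows "word_value G f u = word_value G f v"
  using uv
proof (induction rule: pres_rel.induct)
  case (append u v u' v')
  thus ?case using pres_rel_words[of _ _ S R] word_value_append[OF f] by metis
next
  case (cancel s b)
  have "f s \<in> carrier G" using f cancel by blast
  thus ?case by simp
next
  case (relation u v)
  thus ?case by (rule R)
qed auto

end

lemma presented_group_universal:
  assumes H: "group H" and f: "f \<in> S \<rightarrow> carrier H"
    and R: "\<And>u v. \<lbrakk>(u, v) \<in> R; u \<in> words S; v \<in> words S\<rbrakk>
      \<Longrightarrow> word_value H f u = word_value H f v"
  shows "\<exists>\<phi> \<in> hom (presented_group S R) H. \<forall>s\<in>S. \<phi> (pres_rel S R `` {[(s, True)]}) = f s"
proof -
  interpret group H by fact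
  \<comment> \<open>All words in a class have the same value, so the image of the class is a singleton.\<close>
  define \<phi> where "\<phi> A = the_elem (word_value H f ` A)" for A
  have \<phi>: "\<phi> (pres_rel S R `` {u}) = word_value H f u" if u: "u \<in> words S" for u
  proof -
    have "word_value H f v = word_value H f u" if "v \<in> pres_rel S R `` {u}" for v
      using word_value_cong_pres_rel[OF f R] that by (metis Image_singleton_iff)
    moreover have "u \<in> pres_rel S R `` {u}" using u by (simp add: pres_rel.refl)
    ultimately have "word_value H f ` (pres_rel S R `` {u}) = {word_value H f u}" by blast
    thus ?thesis by (simp add: \<phi>_def)
  qed
  have "\<phi> \<in> hom (presented_group S R) H"
  proof (rule homI)
    fix A assume "A \<in> carrier (presented_group S R)"
    then obtain u where u: "u \<in> words S" "A = pres_rel S R `` {u}"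
      by (auto simp: presented_group_def quotient_def)
    thus "\<phi> A \<in> carrier H" using \<phi> word_value_closed[OF f] by simp
  next
    fix A B assume "A \<in> carrier (presented_group S R)" "B \<in> carrier (presented_group S R)"
    then obtain u v where u: "u \<in> words S" "A = pres_rel S R `` {u}"
      and v: "v \<in> words S" "B = pres_rel S R `` {v}"
      by (auto simp: presented_group_def quotient_def)
    have "u @ v \<in> words S" using u(1) v(1) by simp
    thus "\<phi> (A \<otimes>\<^bsub>presented_group S R\<^esub> B) = \<phi> A \<otimes>\<^bsub>H\<^esub> \<phi> B"
      using u v \<phi> by (simp add: presented_group_mult word_value_append[OF f])
  qed
  moreover have "\<phi> (pres_rel S R `` {[(s, True)]}) = f s" if "s \<in> S" for s
    using \<phi>[of "[(s, True)]"] that funcset_mem[OF f that] by simp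
  ultimately show ?thesis by blast
qed

lemma presented_group_class_closed:
  "u \<in> words S \<Longrightarrow> pres_rel S R `` {u} \<in> carrier (presented_group S R)"
  by (auto simp: presented_group_def quotient_def)

lemma presented_group_inv_generator:
  assumes s: "s \<in> S"
  shows "inv\<^bsub>presented_group S R\<^esub> (pres_rel S R `` {[(s, True)]}) = pres_rel S R `` {[(s, False)]}"
proof (rule group.inv_equality[OF group_presented_group])
  have "([(s, False), (s, True)], []) \<in> pres_rel S R"
    using pres_rel.cancel[OF s, of False R] by simp
  hence "pres_rel S R `` {[(s, False), (s, True)]} = pres_rel S R `` {[]}"
    by (rule equiv_class_eq[OF equiv_pres_rel])
  thus "pres_rel S R `` {[(s, False)]} \<otimes>\<^bsub>presented_group S R\<^esub> pres_rel S R `` {[(s, True)]}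
      = \<one>\<^bsub>presented_group S R\<^esub>"
    using presented_group_mult[of "[(s, False)]" S "[(s, True)]" R] s
    by (simp add: presented_group_def)
qed (use s in \<open>auto intro: presented_group_class_closed\<close>)

lemma presented_group_generated:
  "carrier (presented_group S R)
    = generate (presented_group S R) ((\<lambda>s. pres_rel S R `` {[(s, True)]}) ` S)"
    (is "carrier ?G = generate ?G ?E")
proof
  interpret group ?G by (rule group_presented_group)
  have E: "?E \<subseteq> carrier ?G" by (auto intro: presented_group_class_closed)
  thus "generate ?G ?E \<subseteq> carrier ?G" by (rule generate_incl)
  have letter: "pres_rel S R `` {[(s, b)]} \<in> generate ?G ?E" if "s \<in> S" for s b
    using that generate.incl[of _ ?E ?G] generate.inv[of _ ?E ?G]
    by (cases b) (auto simp: presented_group_inv_generator[symmetric])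
  have "pres_rel S R `` {u} \<in> generate ?G ?E" if "u \<in> words S" for u
    using that
  proof (induction u rule: lists.induct)
    case Nil
    show ?case using generate.one[of ?G ?E] by (simp add: presented_group_def)
  next
    case (Cons a u)
    obtain s b where a: "a = (s, b)" "s \<in> S" using Cons(1) by blast
    have "pres_rel S R `` {a # u} = pres_rel S R `` {[(s, b)]} \<otimes>\<^bsub>?G\<^esub> pres_rel S R `` {u}"
      using a Cons(2) presented_group_mult[of "[(s, b)]" S u R] by simp
    thus ?case using generate.eng[OF letter[OF a(2)] Cons(3)] by simp
  qed
  thus "carrier ?G \<subseteq> generate ?G ?E"
    by (auto simp: presented_group_def quotient_def)
qed


section \<open>The associated group of a finite quandle\<close>

definition quandle_gen :: "'a set \<Rightarrow> ('a \<Rightarrow> 'a \<Rightarrow> 'a) \<Rightarrow> 'a \<Rightarrow> 'a word set" where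
  "quandle_gen Q op x =
    pres_rel Q {([(op x y, True)], [(y, False), (x, True), (y, True)]) | x y. x \<in> Q \<and> y \<in> Q}
      `` {[(x, True)]}"

lemma group_associated_group: "group (associated_group Q op)"
  unfolding associated_group_def by (rule group_presented_group)

lemma quandle_gen_closed: "x \<in> Q \<Longrightarrow> quandle_gen Q op x \<in> carrier (associated_group Q op)"
  unfolding associated_group_def quandle_gen_def by (rule presented_group_class_closed) simp

lemma associated_group_generated:
  "carrier (associated_group Q op) = generate (associated_group Q op) (quandle_gen Q op ` Q)"
  unfolding associated_group_def quandle_gen_def[abs_def] by (rule presented_group_generated)

context quandle
begin

abbreviation "As \<equiv> associated_group Q op"
abbreviation "gen \<equiv> quandle_gen Q op"

lemma gen_op:
  assumes x: "x \<in> Q" and y: "y \<in> Q"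
  shows "gen (x \<triangleright> y) = inv\<^bsub>As\<^esub> gen y \<otimes>\<^bsub>As\<^esub> gen x \<otimes>\<^bsub>As\<^esub> gen y"
proof -
  let ?R = "{([(x \<triangleright> y, True)], [(y, False), (x, True), (y, True)]) | x y. x \<in> Q \<and> y \<in> Q}"
  have As: "As = presented_group Q ?R" and gen: "gen z = pres_rel Q ?R `` {[(z, True)]}" for z
    by (simp_all only: associated_group_def quandle_gen_def)
  have "([(x \<triangleright> y, True)], [(y, False), (x, True), (y, True)]) \<in> pres_rel Q ?R"
    using x y closed by (intro pres_rel.relation) auto
  hence "gen (x \<triangleright> y) = pres_rel Q ?R `` {[(y, False), (x, True), (y, True)]}"
    unfolding gen by (rule equiv_class_eq[OF equiv_pres_rel])
  thus ?thesis
    unfolding As gen presented_group_inv_generator[OF y]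
    using x y by (simp add: presented_group_mult)
qed

lemma finite_conjugation_closed_generators_gen:
  assumes "finite Q"
  shows "finite_conjugation_closed_generators As (gen ` Q)"
proof (rule finite_conjugation_closed_generators.intro[OF group_associated_group],
    rule finite_conjugation_closed_generators_axioms.intro)
  show "finite (gen ` Q)" using assms by (rule finite_imageI)
  show "gen ` Q \<subseteq> carrier As" by (rule image_subsetI) (rule quandle_gen_closed)
  show "carrier As = generate As (gen ` Q)" by (rule associated_group_generated)
  fix e f assume "e \<in> gen ` Q" "f \<in> gen ` Q"
  then obtain x y where xy: "x \<in> Q" "y \<in> Q" "e = gen x" "f = gen y" by blast
  have "gen (x \<triangleright> y) \<in> gen ` Q" using closed[OF xy(1,2)] by (rule imageI)
  thus "inv\<^bsub>As\<^esub> f \<otimes>\<^bsub>As\<^esub> e \<otimes>\<^bsub>As\<^esub> f \<in> gen ` Q"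
    by (simp only: xy(3,4) gen_op[OF xy(1,2)])
qed

lemma hom_to_integers:
  assumes inv: "\<And>x y. \<lbrakk>x \<in> Q; y \<in> Q\<rbrakk> \<Longrightarrow> f (x \<triangleright> y) = f x"
  shows "\<exists>\<phi> \<in> hom As integer_group. \<forall>x\<in>Q. \<phi> (gen x) = f x"
  unfolding associated_group_def quandle_gen_def
  by (rule presented_group_universal) (use inv in auto)

text \<open>
  As \<open>gen x\<close> and \<open>gen (x \<triangleright> y)\<close> are conjugate, their \<open>n\<close>-th powers agree once these are
  central. Hence the value of \<open>gen x [^] n\<close> is constant on the orbits of \<open>Q\<close>, and its fibres
  can serve in place of the orbits: the exponent sum over the generators in one fibre is a
  homomorphism.
\<close>

lemma hom_counting_power:
  assumes central: "\<And>x. x \<in> Q \<Longrightarrow> gen x [^]\<^bsub>As\<^esub> (n::nat) \<in> center As"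
  shows "\<exists>\<psi> \<in> hom As integer_group.
    \<forall>x\<in>Q. \<psi> (gen x) = (if gen x [^]\<^bsub>As\<^esub> n = c then 1 else 0)"
proof (rule hom_to_integers)
  interpret As: group As by (rule group_associated_group)
  fix x y assume xy: "x \<in> Q" "y \<in> Q"
  have "gen (x \<triangleright> y) [^]\<^bsub>As\<^esub> n = inv\<^bsub>As\<^esub> gen y \<otimes>\<^bsub>As\<^esub> gen x [^]\<^bsub>As\<^esub> n \<otimes>\<^bsub>As\<^esub> gen y"
    unfolding gen_op[OF xy]
    by (intro As.pow_conj quandle_gen_closed xy)
  also have "\<dots> = gen x [^]\<^bsub>As\<^esub> n"
    by (intro As.conj_central central quandle_gen_closed xy)
  finally show "(if gen (x \<triangleright> y) [^]\<^bsub>As\<^esub> n = c then 1 else 0)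
      = (if gen x [^]\<^bsub>As\<^esub> n = c then 1 else 0)"
    by simp
qed

end

theorem proposition5p6:
  fixes Q :: "'a set" and op :: "'a \<Rightarrow> 'a \<Rightarrow> 'a"
  assumes "quandle Q op" and "finite Q"
  shows "residually_finite (associated_group Q op)"
proof -
  interpret quandle Q op by fact
  interpret As: finite_conjugation_closed_generators As "gen ` Q"
    using assms(2) by (rule finite_conjugation_closed_generators_gen)
  obtain n :: nat where n: "n > 0" "\<And>y. y \<in> gen ` Q \<Longrightarrow> y [^]\<^bsub>As\<^esub> n \<in> center As"
    using As.common_central_exponent by blast
  define C where "C = (\<lambda>y. y [^]\<^bsub>As\<^esub> n) ` gen ` Q"
  have C: "finite C" "C \<subseteq> center As"
    using assms(2) n(2) by (auto simp: C_def)
  obtain \<psi> where \<psi>: "\<And>c. \<psi> c \<in> hom As integer_group"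
    "\<And>c x. x \<in> Q \<Longrightarrow> \<psi> c (gen x) = (if gen x [^]\<^bsub>As\<^esub> n = c then 1 else 0)"
    using hom_counting_power[of n] n(2) by (metis imageI)
  have dual: "\<psi> c d = (if d = c then int n else 0)" if d: "d \<in> C" for c d
  proof -
    obtain x where x: "x \<in> Q" "d = gen x [^]\<^bsub>As\<^esub> n" using d by (auto simp: C_def)
    interpret \<psi>: group_hom As integer_group "\<psi> c"
      using \<psi>(1) by (simp add: group_hom_def group_hom_axioms_def As.is_group)
    have "\<psi> c d = int n * \<psi> c (gen x)"
      unfolding x(2) using \<psi>.hom_nat_pow[OF quandle_gen_closed[OF x(1)]] by simp
    thus ?thesis using \<psi>(2)[OF x(1)] x(2) by simp
  qed
  show ?thesis
    unfolding residually_finite_def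
  proof (intro conjI ballI impI)
    show "group As" by (rule group_associated_group)
    fix g assume g: "g \<in> carrier As" "g \<noteq> \<one>\<^bsub>As\<^esub>"
    show "\<exists>(F :: nat monoid) \<phi>. group F \<and> finite (carrier F) \<and> \<phi> \<in> hom As F \<and> \<phi> g \<noteq> \<one>\<^bsub>F\<^esub>"
    proof (cases "g \<in> generate As C")
      case True
      have "\<exists>c. \<psi> c g \<noteq> 0"
      proof (rule ccontr)
        assume vanish: "\<not> ?thesis"
        have "g = \<one>\<^bsub>As\<^esub>"
          by (rule As.trivial_if_dual_homs_vanish[OF C _ \<psi>(1) dual True])
            (use n(1) vanish in auto)
        thus False using g(2) by simp
      qed
      then obtain c where "\<psi> c g \<noteq> 0" by blast
      thus ?thesis
        using separated_by_hom_to_residually_finite[OF residually_finite_integer_group \<psi>(1) g(1)]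
        by simp
    next
      case False
      interpret A: normal "generate As C" As
        by (rule As.normal_generate_central[OF C(2)])
      have "residually_finite (As Mod generate As C)"
        using A.factorgroup_is_group As.finite_quotient_by_powers[OF n, folded C_def]
        by (rule residually_finite_if_finite)
      moreover have "generate As C #>\<^bsub>As\<^esub> g \<noteq> \<one>\<^bsub>As Mod generate As C\<^esub>"
        using False g(1) As.rcos_self[OF g(1) A.is_subgroup] by (auto simp: FactGroup_def)
      ultimately show ?thesis
        using separated_by_hom_to_residually_finite[OF _ A.r_coset_hom_Mod g(1)] by blast
    qed
  qed
qed

end
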